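(* Let $u\in\mathcal{C}^{1,1}(\mathbb{R}^n)$ have $1$-Lipschitz derivative, and let $\mathcal{S}_1,\mathcal{S}_2$ be two distinct leaves of $Du$ intersecting along their common (non-empty) face $\mathcal{F}_{12}=\mathcal{S}_1\cap\mathcal{S}_2$. For $i=1,2$ let $V(\mathcal{S}_i)=V(\mathcal{S}_i)_1\oplus V(\mathcal{S}_i)_2$ be the orthogonal decomposition of the tangent space of $\mathcal{S}_i$ induced by $Du$. Let $z_0\in\mathcal{F}_{12}$. Then for every $x\in\mathcal{S}_1$, $y\in\mathcal{S}_2$ and $z\in\mathcal{F}_{12}$: $$(1)\quad\langle P_{V(\mathcal{S}_1)_1}(x-z_0),P_{V(\mathcal{S}_2)_2}(y-z_0)\rangle\le0,$$ $$(2)\quad\langle P_{V(\mathcal{S}_1)_2}(x-z_0),P_{V(\mathcal{S}_2)_1}(y-z_0)\rangle\le0,$$ $$(3)\quad P_{V(\mathcal{S}_1)_1}(z-z_0)=P_{V(\mathcal{S}_2)_1}(z-z_0),\qquad P_{V(\mathcal{S}_1)_2}(z-z_0)=P_{V(\mathcal{S}_2)_2}(z-z_0).$$ Moreover, (4) for each $x\in\mathrm{int}\,\mathcal{S}_1$ and $y\in\mathrm{int}\,\mathcal{S}_2$ at least one of the inequalities (1), (2) is strict. Conversely, let $\mathcal{S}_1,\mathcal{S}_2\subset\mathbb{R}^n$ be convex sets intersecting along their common non-empty face $\mathcal{F}_{12}=\mathcal{S}_1\cap\mathcal{S}_2=\partial\mathcal{S}_1\cap\partial\mathcal{S}_2$,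 let $V(\mathcal{S}_i)=V(\mathcal{S}_i)_1\oplus V(\mathcal{S}_i)_2$, $i=1,2$, be orthogonal decompositions of their tangent spaces, let $z_0\in\mathcal{F}_{12}$, and suppose that (1), (2), (3) hold for all $x\in\mathcal{S}_1,y\in\mathcal{S}_2,z\in\mathcal{F}_{12}$ and that (4) holds. Define $u$ on $\mathcal{S}_1\cup\mathcal{S}_2$ by $$u(x)=\tfrac12\|P_{V(\mathcal{S}_i)_1}(x-z_0)\|^2-\tfrac12\|P_{V(\mathcal{S}_i)_2}(x-z_0)\|^2\quad\text{for }x\in\mathcal{S}_i,\ i=1,2,$$ (so that $D^2u|_{\mathcal{S}_i}=P_{V(\mathcal{S}_i)_1}-P_{V(\mathcal{S}_i)_2}$). Then there exists $\tilde u\in\mathcal{C}^{1,1}(\mathbb{R}^n)$ with $1$-Lipschitz derivative, extending $u$, such that $\mathcal{S}_1,\mathcal{S}_2$ are contained in two distinct leaves of $D\tilde u$.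
   Context: $\|\cdot\|$ is the Euclidean norm and $P_W$ the orthogonal projection onto a subspace $W\subset\mathbb{R}^n$. $\mathcal{C}^{1,1}(\mathbb{R}^n)$ is the set of differentiable real functions with Lipschitz derivative; $Du$ is identified with the gradient map $\mathbb{R}^n\to\mathbb{R}^n$, and $u$ has $1$-Lipschitz derivative if $\|Du(x)-Du(y)\|\le\|x-y\|$ for all $x,y$. A leaf of a $1$-Lipschitz map $v\colon\mathbb{R}^n\to\mathbb{R}^m$ is a set $\mathcal{S}\subset\mathbb{R}^n$, maximal with respect to inclusion, such that $\|v(x)-v(y)\|=\|x-y\|$ for all $x,y\in\mathcal{S}$. Leaves are closed and convex. A face of a convex set $\mathcal{F}$ is a (convex) subset $\mathcal{G}\subset\mathcal{F}$ such that $x,y\in\mathcal{F}$, $t\in(0,1)$, $tx+(1-t)y\in\mathcal{G}$ imply $x,y\in\mathcal{G}$. $\mathrm{int}$ and $\partial$ denote relative interior and relative boundary (with respect to the affine hull). The tangent space of a convex set is $V(\mathcal{S})=\mathrm{span}\{x-y\mid x,y\in\mathcal{S}\}$. For a leaf $\mathcal{S}$ of a $1$-Lipschitz $Du$, the orthogonal decomposition $V(\mathcal{S})=V(\mathcal{S})_1\oplus V(\mathcal{S})_2$ induced by $Du$ is the unique one such that $Du(x)-Du(y)=(P_{V(\mathcal{S})_1}-P_{V(\mathcal{S})_2})(x-y)$ for all $x,y\in\mathcal{S}$. *)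

theory Defs
  imports "HOL-Analysis.Analysis"
begin

definition grad :: "('a::euclidean_space \<Rightarrow> real) \<Rightarrow> 'a \<Rightarrow> 'a" where
  "grad u x = (THE g. GDERIV u x :> g)"

lemma grad_eqI:
  fixes u :: "'a::euclidean_space \<Rightarrow> real"
  assumes "GDERIV u x :> g"
  shows "grad u x = g"
  unfolding grad_def
proof (rule the_equality[where P = "\<lambda>g. GDERIV u x :> g", OF assms])
  fix g' assume "GDERIV u x :> g'"
  with assms have "(\<lambda>h. inner h g') = (\<lambda>h. inner h g)"
    unfolding gderiv_def by (intro has_derivative_unique)
  then show "g' = g"
    by (metis vector_eq_ldot)
qed

definition C11 :: "('a::euclidean_space \<Rightarrow> real) \<Rightarrow> bool" where
  "C11 u \<longleftrightarrow> (\<forall>x. u differentiable (at x)) \<and> (\<exists>L. L-lipschitz_on UNIV (grad u))"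

definition isometric_on :: "'a::real_normed_vector set \<Rightarrow> ('a \<Rightarrow> 'b::real_normed_vector) \<Rightarrow> bool" where
  "isometric_on S v \<longleftrightarrow> (\<forall>x\<in>S. \<forall>y\<in>S. norm (v x - v y) = norm (x - y))"

definition is_leaf :: "('a::real_normed_vector \<Rightarrow> 'b::real_normed_vector) \<Rightarrow> 'a set \<Rightarrow> bool" where
  "is_leaf v S \<longleftrightarrow> isometric_on S v \<and> (\<forall>T. S \<subseteq> T \<longrightarrow> isometric_on T v \<longrightarrow> T = S)"

definition tangent_space :: "'a::real_vector set \<Rightarrow> 'a set" where
  "tangent_space S = span {x - y |x y. x \<in> S \<and> y \<in> S}"

definition orth_proj :: "'a::euclidean_space set \<Rightarrow> 'a \<Rightarrow> 'a" where
  "orth_proj W x = (THE p. p \<in> W \<and> (\<forall>w\<in>W. orthogonal (x - p) w))"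

lemma orth_proj_eqI:
  assumes "subspace W" "p \<in> W" "\<forall>w\<in>W. orthogonal (x - p) w"
  shows "orth_proj W x = p"
  unfolding orth_proj_def
proof (rule the_equality)
  show "p \<in> W \<and> (\<forall>w\<in>W. orthogonal (x - p) w)"
    using assms by blast
next
  fix q assume q: "q \<in> W \<and> (\<forall>w\<in>W. orthogonal (x - q) w)"
  then have "q - p \<in> W"
    using assms by (simp add: subspace_diff)
  then have "orthogonal (x - p) (q - p)" "orthogonal (x - q) (q - p)"
    using assms q by blast+
  then have "inner (q - p) (q - p) = 0"
    by (simp add: orthogonal_def inner_diff_left)
  then show "q = p"
    by simp
qed

lemma orth_proj_works:
  assumes "subspace W"
  shows "orth_proj W x \<in> W" "\<forall>w\<in>W. orthogonal (x - orth_proj W x) w"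
proof -
  obtain y z where "y \<in> span W" "\<And>w. w \<in> span W \<Longrightarrow> orthogonal z w" "x = y + z"
    using orthogonal_subspace_decomp_exists by blast
  then have y: "y \<in> W" "\<forall>w\<in>W. orthogonal (x - y) w"
    using assms by (auto simp: span_base span_eq_iff[THEN iffD2])
  from orth_proj_eqI[OF assms this] y
  show "orth_proj W x \<in> W" "\<forall>w\<in>W. orthogonal (x - orth_proj W x) w"
    by simp_all
qed

definition orth_decomp :: "'a::euclidean_space set \<Rightarrow> 'a set \<Rightarrow> 'a set \<Rightarrow> bool" where
  "orth_decomp V V1 V2 \<longleftrightarrow>
     subspace V1 \<and> subspace V2 \<and> (\<forall>a\<in>V1. \<forall>b\<in>V2. orthogonal a b) \<and> V1 + V2 = V"

definition induced_decomp ::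
    "('a::euclidean_space \<Rightarrow> real) \<Rightarrow> 'a set \<Rightarrow> 'a set \<Rightarrow> 'a set \<Rightarrow> bool" where
  "induced_decomp u S V1 V2 \<longleftrightarrow>
     orth_decomp (tangent_space S) V1 V2 \<and>
     (\<forall>x\<in>S. \<forall>y\<in>S. grad u x - grad u y = orth_proj V1 (x - y) - orth_proj V2 (x - y))"

end

theory Submission
  imports Defs
begin

text \<open>
  The link between the geometry and the regularity is a single quantity, the \<^emph>\<open>Wells gap\<close> of
  a one-jet \<open>(f, G)\<close> at an ordered pair of points,
  \<open>f x + 1/2 * inner (G x + G y) (y - x) + 1/4 * |x - y|\<^sup>2 - 1/4 * |G x - G y|\<^sup>2 - f y\<close>.
  A function on the whole space has a 1-Lipschitz gradient \<open>G\<close> precisely when all of its gaps are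
  nonnegative (lemmas \<open>wells_gap_nonneg_of_gradient\<close> and \<open>wells_gap_nonneg_imp_gradient\<close>), and a
  jet on an arbitrary nonempty set whose gaps are nonnegative extends to such a function (lemma
  \<open>wells_extension\<close>). The gaps at \<open>(x, y)\<close> and \<open>(y, x)\<close> add up to
  \<open>1/2 * (|x - y|\<^sup>2 - |G x - G y|\<^sup>2)\<close>, so that for nonnegative gaps the map \<open>G\<close> preserves the
  distance of \<open>x\<close> and \<open>y\<close> iff both gaps vanish.

  For \<open>x \<in> S\<^sub>1\<close> and \<open>y \<in> S\<^sub>2\<close>, where the jet is on each \<open>S\<^sub>i\<close> the quadratic one given by the
  decomposition of its tangent space, the gap at \<open>(x, y)\<close> equals
  \<open>-2 * inner x\<^sub>2 y\<^sub>1\<close> and the gap at \<open>(y, x)\<close> equals \<open>-2 * inner x\<^sub>1 y\<^sub>2\<close>, indices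
  denoting the components of \<open>x - z0\<close> and \<open>y - z0\<close>; inside a single \<open>S\<^sub>i\<close> all gaps vanish (lemmas
  \<open>wells_gap_quad_on\<close> and \<open>wells_gap_quad_on_self\<close>). The sign conditions are therefore equivalent
  to the nonnegativity of the gaps, and strictness in one of them says that \<open>G\<close> contracts the pair
  \<open>(x, y)\<close>.

  Given two leaves of \<open>grad u\<close>, the sign conditions follow at once. If strictness failed at
  relatively interior points, the two inner products, which are linear in each argument, nonpositive
  and zero at a relatively interior point, would vanish throughout \<open>S\<^sub>1 \<times> S\<^sub>2\<close>. Then \<open>grad u\<close>
  would be isometric on \<open>S\<^sub>1 \<union> S\<^sub>2\<close>, against the maximality of two distinct leaves. Conversely, the
  sign conditions allow the jet on \<open>S\<^sub>1 \<union> S\<^sub>2\<close> to be extended, each \<open>S\<^sub>i\<close> lies in some leaf by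
  Zorn's lemma, and a leaf containing both would contradict strictness.
\<close>

section \<open>The Wells gap of a one-jet\<close>

text \<open>
  The gap is not symmetric in \<open>x\<close> and \<open>y\<close>. The constants \<open>1/4\<close> correspond to Lipschitz constant
  one for the gradient.
\<close>

definition wells_gap :: "('a::real_inner \<Rightarrow> real) \<Rightarrow> ('a \<Rightarrow> 'a) \<Rightarrow> 'a \<Rightarrow> 'a \<Rightarrow> real" where
  "wells_gap f G x y =
     f x + 1/2 * inner (G x + G y) (y - x) + 1/4 * (norm (x - y))\<^sup>2
       - 1/4 * (norm (G x - G y))\<^sup>2 - f y"

lemma wells_gap_add_swap:
  "wells_gap f G x y + wells_gap f G y x = 1/2 * ((norm (x - y))\<^sup>2 - (norm (G x - G y))\<^sup>2)"
  unfolding wells_gap_def power2_norm_eq_inner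
  by (simp add: inner_simps inner_commute field_simps)

lemma gderiv_grad:
  fixes u :: "'a::euclidean_space \<Rightarrow> real"
  assumes "u differentiable (at x)"
  shows "GDERIV u x :> grad u x"
proof -
  obtain D where D: "(u has_derivative D) (at x)"
    using assms by (auto simp: differentiable_def)
  then have "linear D"
    by (rule has_derivative_linear)
  then have "D = (\<lambda>h. inner h (adjoint D 1))"
    by (simp add: adjoint_works)
  with D have "GDERIV u x :> adjoint D 1"
    by (simp add: gderiv_def)
  then show ?thesis
    using grad_eqI by metis
qed

lemma descent_upper:
  fixes u :: "'a::real_inner \<Rightarrow> real"
  assumes D: "\<And>x. GDERIV u x :> G x" and L: "1-lipschitz_on UNIV G"
  shows "u z \<le> u x + inner (G x) (z - x) + 1/2 * (norm (z - x))\<^sup>2"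
proof -
  define d where "d = z - x"
  define \<phi> where "\<phi> t = u (x + t *\<^sub>R d) - t * inner (G x) d - t\<^sup>2 / 2 * (norm d)\<^sup>2" for t :: real
  have der: "DERIV \<phi> t :> inner (G (x + t *\<^sub>R d)) d - inner (G x) d - t * (norm d)\<^sup>2" for t
  proof -
    have "((\<lambda>t. x + t *\<^sub>R d) has_derivative (\<lambda>s. s *\<^sub>R d)) (at t)"
      by (auto intro!: derivative_eq_intros)
    moreover have "(u has_derivative (\<lambda>h. inner h (G (x + t *\<^sub>R d)))) (at (x + t *\<^sub>R d))"
      using D by (simp add: gderiv_def)
    ultimately have "((\<lambda>t. u (x + t *\<^sub>R d)) has_derivative (\<lambda>s. inner (s *\<^sub>R d) (G (x + t *\<^sub>R d)))) (at t)"
      by (rule has_derivative_compose)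
    then have "DERIV (\<lambda>t. u (x + t *\<^sub>R d)) t :> inner (G (x + t *\<^sub>R d)) d"
      by (simp add: has_field_derivative_def inner_commute mult_commute_abs)
    then show ?thesis
      unfolding \<phi>_def by (auto intro!: derivative_eq_intros)
  qed
  have "\<phi> 1 \<le> \<phi> 0"
  proof (rule DERIV_nonpos_imp_nonincreasing[of 0 1 \<phi>])
    fix t :: real assume t: "0 \<le> t" "t \<le> 1"
    have "inner (G (x + t *\<^sub>R d) - G x) d \<le> norm (G (x + t *\<^sub>R d) - G x) * norm d"
      by (rule norm_cauchy_schwarz)
    also have "\<dots> \<le> (t * norm d) * norm d"
      using lipschitz_onD[OF L, of "x + t *\<^sub>R d" x] t
      by (intro mult_right_mono) (auto simp: dist_norm)
    finally have "inner (G (x + t *\<^sub>R d)) d - inner (G x) d - t * (norm d)\<^sup>2 \<le> 0"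
      by (simp add: inner_diff_left power2_eq_square)
    with der show "\<exists>y. DERIV \<phi> t :> y \<and> y \<le> 0"
      by blast
  qed simp
  then show ?thesis
    by (simp add: \<phi>_def d_def)
qed

lemma descent_lower:
  fixes u :: "'a::real_inner \<Rightarrow> real"
  assumes D: "\<And>x. GDERIV u x :> G x" and L: "1-lipschitz_on UNIV G"
  shows "u x + inner (G x) (z - x) - 1/2 * (norm (z - x))\<^sup>2 \<le> u z"
proof -
  have "GDERIV (\<lambda>x. - u x) x :> - G x" for x
    using D[of x] by (rule GDERIV_minus)
  moreover have "1-lipschitz_on UNIV (\<lambda>x. - G x)"
    using L by (simp add: lipschitz_on_def dist_norm norm_minus_commute)
  ultimately have "- u z \<le> - u x + inner (- G x) (z - x) + 1/2 * (norm (z - x))\<^sup>2"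
    by (rule descent_upper)
  then show ?thesis by simp
qed

text \<open>
  The lower paraboloid touching \<open>u\<close> at \<open>y\<close> lies below the upper paraboloid touching \<open>u\<close> at \<open>x\<close>;
  the gap is the minimum of their difference.
\<close>

lemma wells_gap_nonneg_of_gradient:
  fixes u :: "'a::real_inner \<Rightarrow> real"
  assumes D: "\<And>x. GDERIV u x :> G x" and L: "1-lipschitz_on UNIV G"
  shows "0 \<le> wells_gap u G x y"
proof -
  \<comment> \<open>the minimizer of the difference of the two paraboloids\<close>
  define z where "z = (1/2) *\<^sub>R (x + y + G y - G x)"
  have "u y + inner (G y) (z - y) - 1/2 * (norm (z - y))\<^sup>2
          \<le> u x + inner (G x) (z - x) + 1/2 * (norm (z - x))\<^sup>2"
    using descent_lower[OF assms] descent_upper[OF assms] order_trans by blast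
  then show ?thesis
    unfolding z_def wells_gap_def power2_norm_eq_inner
    by (simp add: inner_simps inner_commute field_simps)
qed

lemma wells_gap_nonneg_imp_gradient:
  fixes F :: "'a::real_inner \<Rightarrow> real"
  assumes "\<And>x y. 0 \<le> wells_gap F G x y"
  shows "GDERIV F x :> G x" and "1-lipschitz_on UNIV G"
proof -
  have up: "F z \<le> F x + inner (G x) (z - x) + 1/2 * (norm (z - x))\<^sup>2" for x z
  proof -
    have "0 \<le> (norm ((G z - G x) - (z - x)))\<^sup>2" by simp
    with assms[of x z] show ?thesis
      unfolding wells_gap_def power2_norm_eq_inner
      by (simp add: inner_simps inner_commute field_simps)
  qed
  have lo: "F x + inner (G x) (z - x) - 1/2 * (norm (z - x))\<^sup>2 \<le> F z" for x z
  proof -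
    have "0 \<le> (norm ((G z - G x) + (z - x)))\<^sup>2" by simp
    with assms[of z x] show ?thesis
      unfolding wells_gap_def power2_norm_eq_inner
      by (simp add: inner_simps inner_commute field_simps)
  qed
  have bd: "norm (F z - F x - inner (z - x) (G x)) \<le> norm (z - x) * norm (z - x)" for z
    using up[of z x] lo[of x z] zero_le_square[of "norm (z - x)"]
    by (simp add: inner_commute power2_eq_square abs_le_iff)
  have "(F has_derivative (\<lambda>h. inner h (G x))) (at x)"
    unfolding has_derivative_at_alt
  proof (intro conjI allI impI bounded_linear_inner_left)
    fix e :: real assume "0 < e"
    then show "\<exists>d>0. \<forall>y. norm (y - x) < d \<longrightarrow>
        norm (F y - F x - inner (y - x) (G x)) \<le> e * norm (y - x)"
      using bd by (intro exI[of _ e]) (smt (verit) mult_right_mono norm_ge_zero)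
  qed
  then show "GDERIV F x :> G x"
    by (simp add: gderiv_def)
  have "norm (G x - G y) \<le> norm (x - y)" for x y
  proof (rule power2_le_imp_le)
    have "0 \<le> wells_gap F G x y + wells_gap F G y x"
      by (intro add_nonneg_nonneg assms)
    then show "(norm (G x - G y))\<^sup>2 \<le> (norm (x - y))\<^sup>2"
      unfolding wells_gap_add_swap by simp
  qed simp
  then show "1-lipschitz_on UNIV G"
    by (simp add: lipschitz_on_def dist_norm)
qed

section \<open>Extension of one-jets\<close>

text \<open>
  The hypothesis is the interpolation condition for convex functions with a 2-Lipschitz gradient, and
  the extension satisfies it everywhere. The construction is by conjugation: such an \<open>h\<close> is the
  conjugate of a function \<open>\<psi>\<close> that is strongly convex with modulus \<open>1/2\<close>, and the smallest
  admissible \<open>\<psi>\<close> is the supremum over \<open>y \<in> E\<close> of the functions \<open>b y\<close> below. As this supremum may be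
  infinite when \<open>E\<close> is unbounded, its epigraph \<open>K\<close> is used in its place: \<open>h x\<close> is the maximum of
  \<open>inner x p - s\<close> over \<open>(p, s) \<in> K\<close>, and the gradient \<open>P x\<close> is the component \<open>p\<close> of a maximizer.
\<close>

lemma smooth_convex_extension:
  fixes f :: "'a::euclidean_space \<Rightarrow> real" and G :: "'a \<Rightarrow> 'a"
  assumes "E \<noteq> {}"
    and E: "\<And>y z. y \<in> E \<Longrightarrow> z \<in> E \<Longrightarrow>
      f y + inner (G y) (z - y) + 1/4 * (norm (G y - G z))\<^sup>2 \<le> f z"
  obtains h P where
    "\<And>x x'. h x + inner (P x) (x' - x) + 1/4 * (norm (P x - P x'))\<^sup>2 \<le> h x'"
    and "\<And>y. y \<in> E \<Longrightarrow> h y = f y" and "\<And>y. y \<in> E \<Longrightarrow> P y = G y"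
proof -
  define b where "b y p = inner y p - f y + 1/4 * (norm (p - G y))\<^sup>2" for y p
  define K where "K = {(p, s). \<forall>y\<in>E. b y p \<le> s}"
  obtain y0 where y0: "y0 \<in> E" using assms(1) by blast
  have KI: "(G y, inner y (G y) - f y) \<in> K" if "y \<in> E" for y
    using E[OF that] unfolding K_def b_def
    by (fastforce simp: inner_diff_right inner_commute norm_minus_commute algebra_simps)
  have K_closed: "closed K"
  proof -
    have "K = (\<Inter>y\<in>E. {q. b y (fst q) \<le> snd q})"
      by (auto simp: K_def)
    moreover have "closed {q. b y (fst q) \<le> snd q}" for y
      unfolding b_def by (intro closed_Collect_le continuous_intros)
    ultimately show ?thesis by auto
  qed
  \<comment> \<open>strong convexity, expressed on the epigraph\<close>
  have K_convex: "((1 - t) *\<^sub>R p + t *\<^sub>R q, (1 - t) * r + t * s - 1/4 * (t * (1 - t)) * (norm (p - q))\<^sup>2) \<in> K"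
    if pq: "(p, r) \<in> K" "(q, s) \<in> K" and t: "0 \<le> t" "t \<le> 1" for p q r s t
  proof -
    have "b y ((1 - t) *\<^sub>R p + t *\<^sub>R q) \<le> (1 - t) * r + t * s - 1/4 * (t * (1 - t)) * (norm (p - q))\<^sup>2"
      if "y \<in> E" for y
    proof -
      have "b y ((1 - t) *\<^sub>R p + t *\<^sub>R q)
          = (1 - t) * b y p + t * b y q - 1/4 * (t * (1 - t)) * (norm (p - q))\<^sup>2"
        unfolding b_def power2_norm_eq_inner
        by (simp add: inner_simps inner_commute field_simps)
      also have "\<dots> \<le> (1 - t) * r + t * s - 1/4 * (t * (1 - t)) * (norm (p - q))\<^sup>2"
        using pq t that by (intro diff_right_mono add_mono mult_left_mono) (auto simp: K_def)
      finally show ?thesis .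
    qed
    then show ?thesis by (simp add: K_def)
  qed
  have attained: "\<exists>q\<in>K. \<forall>q'\<in>K. inner x (fst q') - snd q' \<le> inner x (fst q) - snd q" for x
  proof -
    define l where "l q = inner x (fst q) - snd q" for q :: "'a \<times> real"
    define a where "a = l (G y0, inner y0 (G y0) - f y0)"
    define C where "C = K \<inter> {q. a \<le> l q}"
    have cont: "continuous_on UNIV l"
      unfolding l_def by (intro continuous_intros)
    have "closed C"
      unfolding C_def using K_closed cont
      by (intro closed_Int closed_Collect_le continuous_intros) auto
    moreover have "bounded C"
    proof -
      \<comment> \<open>completing the square in \<open>p\<close>: the constraint at \<open>y0\<close> confines \<open>p\<close> to a ball around \<open>v\<close>\<close>
      define v where "v = G y0 - 2 *\<^sub>R (y0 - x)"
      define R where "R = f y0 - a - 1/4 * (norm (G y0))\<^sup>2 + 1/4 * (norm v)\<^sup>2"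
      define B where "B = norm v + (\<bar>R\<bar> * 4 + 1)"
      define m where "m = norm x * B + \<bar>a\<bar>"
      define m' where "m' = norm y0 * B + \<bar>f y0\<bar>"
      have "C \<subseteq> cball 0 B \<times> {- m' .. m}"
      proof clarify
        fix p s assume "(p, s) \<in> C"
        then have s: "b y0 p \<le> s" "a \<le> inner x p - s"
          using y0 by (auto simp: C_def K_def l_def)
        then have "b y0 p - inner x p + a \<le> 0" by simp
        moreover have "b y0 p - inner x p + a = 1/4 * (norm (p - v))\<^sup>2 - R"
          unfolding b_def R_def v_def power2_norm_eq_inner
          by (simp add: inner_simps inner_commute field_simps)
        ultimately have "(norm (p - v))\<^sup>2 \<le> 4 * \<bar>R\<bar>" by simp
        also have "\<dots> \<le> (\<bar>R\<bar> * 4 + 1)\<^sup>2"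
          by (simp add: power2_eq_square algebra_simps)
        finally have "norm (p - v) \<le> \<bar>R\<bar> * 4 + 1"
          by (rule power2_le_imp_le) simp
        then have p: "norm p \<le> B"
          unfolding B_def using norm_triangle_sub[of p v] by simp
        have "\<bar>inner z p\<bar> \<le> norm z * B" for z
          using Cauchy_Schwarz_ineq2[of z p] mult_left_mono[OF p norm_ge_zero[of z]] by linarith
        from this[of x] this[of y0]
        have "\<bar>inner x p\<bar> \<le> norm x * B" "\<bar>inner y0 p\<bar> \<le> norm y0 * B" .
        moreover have "inner y0 p - f y0 \<le> s"
          using s(1) unfolding b_def by simp (use zero_le_power2[of "norm (p - G y0)"] in linarith)
        ultimately have "- m' \<le> s" "s \<le> m"
          using s(2) unfolding m_def m'_def by linarith+
        with p show "p \<in> cball 0 B \<and> s \<in> {- m' .. m}"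
          by simp
      qed
      then show ?thesis
        by (rule bounded_subset[rotated]) (intro bounded_Times bounded_cball bounded_closed_interval)
    qed
    ultimately have "compact C"
      by (simp add: compact_eq_bounded_closed)
    moreover have "(G y0, inner y0 (G y0) - f y0) \<in> C"
      using KI[OF y0] by (simp add: C_def a_def)
    ultimately obtain q where q: "q \<in> C" "\<forall>q'\<in>C. l q' \<le> l q"
      using continuous_attains_sup[of C l] cont continuous_on_subset by (metis empty_iff subset_UNIV)
    then have "\<forall>q'\<in>K. l q' \<le> l q"
      unfolding C_def by fastforce
    with q show ?thesis
      by (auto simp: C_def l_def)
  qed
  then obtain Q where QK: "\<And>x. Q x \<in> K"
    and Q: "\<And>x q'. q' \<in> K \<Longrightarrow> inner x (fst q') - snd q' \<le> inner x (fst (Q x)) - snd (Q x)"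
    by metis
  define P where "P x = fst (Q x)" for x
  define h where "h x = inner x (P x) - snd (Q x)" for x
  \<comment> \<open>quadratic decay away from the maximizer: compare with points of the segment towards \<open>(p, s)\<close> and let them tend to the maximizer\<close>
  have strong: "inner x p - s + 1/4 * (norm (P x - p))\<^sup>2 \<le> h x" if ps: "(p, s) \<in> K" for x p s
  proof -
    have *: "(1 - t) * (1/4 * (norm (P x - p))\<^sup>2) \<le> h x - (inner x p - s)" if t: "0 < t" "t \<le> 1" for t
    proof -
      have "inner x ((1 - t) *\<^sub>R P x + t *\<^sub>R p)
          - ((1 - t) * snd (Q x) + t * s - 1/4 * (t * (1 - t)) * (norm (P x - p))\<^sup>2) \<le> h x"
        using Q[OF K_convex[of "P x" "snd (Q x)" p s t], of x] QK[of x] ps t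
        by (simp add: P_def h_def)
      then have "t * ((1 - t) * (1/4 * (norm (P x - p))\<^sup>2)) \<le> t * (h x - (inner x p - s))"
        by (simp add: h_def inner_simps algebra_simps)
      with t show ?thesis by simp
    qed
    have "((\<lambda>t. (1 - t) * (1/4 * (norm (P x - p))\<^sup>2)) \<longlongrightarrow> (1 - 0) * (1/4 * (norm (P x - p))\<^sup>2)) (at_right 0)"
      by (intro tendsto_intros)
    moreover have "eventually (\<lambda>t. (1 - t) * (1/4 * (norm (P x - p))\<^sup>2) \<le> h x - (inner x p - s)) (at_right (0::real))"
      using * unfolding eventually_at_right_field by (intro exI[of _ 1]) (metis less_imp_le zero_less_one)
    ultimately have "(1 - 0) * (1/4 * (norm (P x - p))\<^sup>2) \<le> h x - (inner x p - s)"
      by (rule tendsto_upperbound) simp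
    then show ?thesis by simp
  qed
  show thesis
  proof
    fix x x'
    have "inner x' (P x) - snd (Q x) + 1/4 * (norm (P x' - P x))\<^sup>2 \<le> h x'"
      using QK[of x] by (intro strong) (simp add: P_def)
    then show "h x + inner (P x) (x' - x) + 1/4 * (norm (P x - P x'))\<^sup>2 \<le> h x'"
      by (simp add: h_def inner_simps inner_commute norm_minus_commute)
  next
    fix y assume y: "y \<in> E"
    have 1: "f y + 1/4 * (norm (P y - G y))\<^sup>2 \<le> h y"
      using strong[OF KI[OF y], of y] by simp
    have "b y (P y) \<le> snd (Q y)"
      using QK[of y] y by (auto simp: K_def P_def split: prod.splits)
    then have 2: "h y \<le> f y - 1/4 * (norm (P y - G y))\<^sup>2"
      by (simp add: b_def h_def)
    from 1 2 have "(norm (P y - G y))\<^sup>2 \<le> 0" by linarith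
    then show "P y = G y" by simp
    with 1 2 show "h y = f y" by simp
  qed
qed

text \<open>
  Adding \<open>1/2 * |x|\<^sup>2\<close> to the function and the identity to the gradient turns nonnegativity of the
  Wells gap into the interpolation condition for convex functions with a 2-Lipschitz gradient.
\<close>

lemma wells_extension:
  fixes f :: "'a::euclidean_space \<Rightarrow> real" and G :: "'a \<Rightarrow> 'a"
  assumes "E \<noteq> {}" and gap: "\<And>x y. x \<in> E \<Longrightarrow> y \<in> E \<Longrightarrow> 0 \<le> wells_gap f G x y"
  obtains F where "C11 F" "1-lipschitz_on UNIV (grad F)"
    "\<And>x. x \<in> E \<Longrightarrow> F x = f x" "\<And>x. x \<in> E \<Longrightarrow> grad F x = G x"
proof -
  have shift: "wells_gap g H x y =
      (g x + 1/2 * (norm x)\<^sup>2) + inner (H y + y) (y - x) - 1/4 * (norm ((H x + x) - (H y + y)))\<^sup>2 - (g y + 1/2 * (norm y)\<^sup>2)"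
    for g :: "'a \<Rightarrow> real" and H x y
    unfolding wells_gap_def power2_norm_eq_inner
    by (simp add: inner_simps inner_commute field_simps)
  obtain h P where hP: "\<And>x x'. h x + inner (P x) (x' - x) + 1/4 * (norm (P x - P x'))\<^sup>2 \<le> h x'"
    and h: "\<And>y. y \<in> E \<Longrightarrow> h y = f y + 1/2 * (norm y)\<^sup>2" and P: "\<And>y. y \<in> E \<Longrightarrow> P y = G y + y"
  proof (rule smooth_convex_extension[OF assms(1), of "\<lambda>y. f y + 1/2 * (norm y)\<^sup>2" "\<lambda>y. G y + y"])
    fix y z assume "y \<in> E" "z \<in> E"
    then have "0 \<le> wells_gap f G z y" by (simp add: gap)
    then show "f y + 1/2 * (norm y)\<^sup>2 + inner (G y + y) (z - y) + 1/4 * (norm (G y + y - (G z + z)))\<^sup>2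
        \<le> f z + 1/2 * (norm z)\<^sup>2"
      unfolding shift by (simp add: inner_simps norm_minus_commute[of "G y + y" "G z + z"])
  qed blast
  define F where "F x = h x - 1/2 * (norm x)\<^sup>2" for x
  define H where "H x = P x - x" for x
  have "0 \<le> wells_gap F H x y" for x y
    using hP[of y x] unfolding shift by (simp add: F_def H_def inner_simps norm_minus_commute[of "P y" "P x"])
  note FH = wells_gap_nonneg_imp_gradient[of F H, OF this]
  have gradF: "grad F = H"
    using FH(1) by (auto intro: grad_eqI)
  show thesis
  proof
    show "C11 F" "1-lipschitz_on UNIV (grad F)"
      using FH unfolding C11_def gradF gderiv_def differentiable_def by blast+
  qed (simp_all add: gradF F_def H_def h P)
qed

section \<open>Orthogonal decompositions and quadratic jets\<close>

lemma orth_proj_add: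
  assumes "subspace W"
  shows "orth_proj W (x + y) = orth_proj W x + orth_proj W y"
proof (rule orth_proj_eqI[OF assms])
  show "orth_proj W x + orth_proj W y \<in> W"
    by (simp add: assms orth_proj_works subspace_add)
  show "\<forall>w\<in>W. orthogonal (x + y - (orth_proj W x + orth_proj W y)) w"
    using orth_proj_works(2)[OF assms, of x] orth_proj_works(2)[OF assms, of y]
    by (simp add: orthogonal_def inner_diff_left inner_add_left)
qed

lemma linear_orth_proj:
  assumes "subspace W"
  shows "linear (orth_proj W)"
proof (rule linearI)
  show "orth_proj W (c *\<^sub>R x) = c *\<^sub>R orth_proj W x" for c x
  proof (rule orth_proj_eqI[OF assms])
    show "c *\<^sub>R orth_proj W x \<in> W"
      by (simp add: assms orth_proj_works subspace_scale)
    show "\<forall>w\<in>W. orthogonal (c *\<^sub>R x - c *\<^sub>R orth_proj W x) w"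
      using orth_proj_works(2)[OF assms, of x]
      by (simp add: orthogonal_def flip: scaleR_diff_right)
  qed
qed (rule orth_proj_add[OF assms])

lemma linear_inner_orth_proj:
  assumes "subspace W"
  shows "linear (\<lambda>x. inner (orth_proj W x) c)" "linear (\<lambda>x. inner c (orth_proj W x))"
  using linear_orth_proj[OF assms]
  by (auto intro!: linearI simp: linear_add linear_cmul inner_simps)

lemma orth_proj_0: "subspace W \<Longrightarrow> orth_proj W 0 = 0"
  by (simp add: linear_0 linear_orth_proj)

lemma orth_decomp_sum:
  assumes dec: "orth_decomp V V1 V2" and "x \<in> V"
  shows "orth_proj V1 x + orth_proj V2 x = x"
proof -
  obtain a b where ab: "a \<in> V1" "b \<in> V2" "x = a + b"
    using assms by (auto simp: orth_decomp_def elim: set_plus_elim)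
  have "orth_proj V1 x = a" "orth_proj V2 x = b"
    using dec ab by (auto intro!: orth_proj_eqI simp: orth_decomp_def orthogonal_commute)
  then show ?thesis using ab by simp
qed

lemma orth_decomp_orthogonal:
  assumes "orth_decomp V V1 V2"
  shows "inner (orth_proj V1 x) (orth_proj V2 y) = 0"
  using assms orth_proj_works(1)[of V1 x] orth_proj_works(1)[of V2 y]
  by (simp add: orth_decomp_def orthogonal_def)

lemma diff_mem_tangent_space: "x \<in> S \<Longrightarrow> y \<in> S \<Longrightarrow> x - y \<in> tangent_space S"
  unfolding tangent_space_def by (intro span_base) blast

lemma wells_gap_quadratic:
  fixes z0 :: "'a::real_inner"
  assumes "inner x1 x2 = 0" "inner y1 y2 = 0"
    and "x - z0 = x1 + x2" "y - z0 = y1 + y2"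
    and "G x = g + x1 - x2" "G y = g + y1 - y2"
    and "f x = c + inner g (x - z0) + 1/2 * (norm x1)\<^sup>2 - 1/2 * (norm x2)\<^sup>2"
    and "f y = c + inner g (y - z0) + 1/2 * (norm y1)\<^sup>2 - 1/2 * (norm y2)\<^sup>2"
  shows "wells_gap f G x y = - 2 * inner x2 y1"
proof -
  have x: "x = z0 + x1 + x2" "y = z0 + y1 + y2"
    using assms(3,4) by (simp_all add: algebra_simps)
  have o: "inner x2 x1 = 0" "inner y2 y1 = 0"
    using assms(1,2) by (simp_all add: inner_commute)
  have "x - y = (x1 + x2) - (y1 + y2)" "y - x = (y1 + y2) - (x1 + x2)"
    using x by simp_all
  moreover have "f x = c + inner g (x1 + x2) + 1/2 * (norm x1)\<^sup>2 - 1/2 * (norm x2)\<^sup>2"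
    "f y = c + inner g (y1 + y2) + 1/2 * (norm y1)\<^sup>2 - 1/2 * (norm y2)\<^sup>2"
    using assms(3,4,7,8) by simp_all
  ultimately have "wells_gap f G x y =
      c + inner g (x1 + x2) + 1/2 * (norm x1)\<^sup>2 - 1/2 * (norm x2)\<^sup>2
      + 1/2 * inner (g + x1 - x2 + (g + y1 - y2)) (y1 + y2 - (x1 + x2))
      + 1/4 * (norm (x1 + x2 - (y1 + y2)))\<^sup>2 - 1/4 * (norm (g + x1 - x2 - (g + y1 - y2)))\<^sup>2
      - (c + inner g (y1 + y2) + 1/2 * (norm y1)\<^sup>2 - 1/2 * (norm y2)\<^sup>2)"
    by (simp only: wells_gap_def assms(5,6))
  also have "\<dots> = - 2 * inner x2 y1"
    unfolding power2_norm_eq_inner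
    using assms(1,2) o by (simp add: inner_simps inner_commute field_simps)
  finally show ?thesis .
qed

text \<open>
  From a relatively interior point \<open>x0\<close> one can move a little within \<open>S\<close> in the direction opposite to
  \<open>x\<close>. No convexity of \<open>S\<close> is needed.
\<close>

lemma linear_nonpos_vanishes:
  fixes l :: "'a::euclidean_space \<Rightarrow> real"
  assumes l: "linear l" and le: "\<And>x. x \<in> S \<Longrightarrow> l (x - z0) \<le> 0"
    and x0: "x0 \<in> rel_interior S" "l (x0 - z0) = 0" and x: "x \<in> S"
  shows "l (x - z0) = 0"
proof -
  obtain e where e: "e > 0" "cball x0 e \<inter> affine hull S \<subseteq> S"
    using x0(1) by (auto simp: rel_interior_cball)
  define k where "k = e / (1 + norm (x0 - x))"
  have k: "k > 0" "k * norm (x0 - x) \<le> e"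
    using e(1) by (auto simp: k_def divide_simps add_pos_nonneg algebra_simps)
  have "x0 \<in> S" using x0(1) rel_interior_subset by blast
  then have "(1 + k) *\<^sub>R x0 + (- k) *\<^sub>R x \<in> affine hull S"
    using x by (intro mem_affine[OF affine_affine_hull]) (auto simp: hull_inc)
  moreover have "(1 + k) *\<^sub>R x0 + (- k) *\<^sub>R x = x0 + k *\<^sub>R (x0 - x)"
    by (simp add: algebra_simps)
  moreover have "x0 + k *\<^sub>R (x0 - x) \<in> cball x0 e"
    using k by (simp add: dist_norm)
  ultimately have "x0 + k *\<^sub>R (x0 - x) \<in> S"
    using e(2) by auto
  then have "l ((x0 - z0) + k *\<^sub>R ((x0 - z0) - (x - z0))) \<le> 0"
    using le by (metis add_diff_eq add.commute diff_diff_eq2 diff_add_cancel)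
  moreover have "l ((x0 - z0) + k *\<^sub>R ((x0 - z0) - (x - z0))) = - (k * l (x - z0))"
    unfolding linear_add[OF l] linear_cmul[OF l] linear_diff[OF l, of "x0 - z0" "x - z0"] x0(2)
    by simp
  ultimately have "0 \<le> l (x - z0)"
    using k(1) by (simp add: zero_le_mult_iff)
  with le[OF x] show ?thesis by simp
qed

lemma isometric_on_subset_leaf:
  assumes "isometric_on S v"
  obtains L where "is_leaf v L" "S \<subseteq> L"
proof -
  let ?A = "{T. S \<subseteq> T \<and> isometric_on T v}"
  have "\<exists>U\<in>?A. \<forall>X\<in>C. X \<subseteq> U" if C: "subset.chain ?A C" for C
  proof (cases "C = {}")
    case True
    then show ?thesis using assms by blast
  next
    case False
    have "isometric_on (\<Union>C) v"
      unfolding isometric_on_def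
    proof (intro ballI)
      fix x y assume "x \<in> \<Union>C" "y \<in> \<Union>C"
      then obtain T where "T \<in> C" "x \<in> T" "y \<in> T"
        using C unfolding subset_chain_def by blast
      then show "norm (v x - v y) = norm (x - y)"
        using C unfolding subset_chain_def isometric_on_def by blast
    qed
    moreover have "S \<subseteq> \<Union>C"
      using C False unfolding subset_chain_def by blast
    ultimately show ?thesis by blast
  qed
  then obtain L where "L \<in> ?A" "\<forall>X\<in>?A. L \<subseteq> X \<longrightarrow> X = L"
    using subset_Zorn[of ?A] by blast
  then show thesis
    using that[of L] unfolding is_leaf_def by auto
qed


text \<open>
  The jet \<open>(f, G)\<close> is quadratic on \<open>S\<close> around the base point \<open>z0\<close>, with second derivative the
  difference of the projections onto \<open>V1\<close> and \<open>V2\<close>. Value and gradient at \<open>z0\<close> are arbitrary, since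
  subtracting an affine function does not change the Wells gap.
\<close>

definition quad_on :: "'a::euclidean_space \<Rightarrow> 'a set \<Rightarrow> ('a \<Rightarrow> real) \<Rightarrow> ('a \<Rightarrow> 'a) \<Rightarrow> 'a set \<Rightarrow> 'a set \<Rightarrow> bool" where
  "quad_on z0 S f G V1 V2 \<longleftrightarrow>
     orth_decomp (tangent_space S) V1 V2 \<and>
     (\<forall>x\<in>S. G x = G z0 + orth_proj V1 (x - z0) - orth_proj V2 (x - z0) \<and>
             f x = f z0 + inner (G z0) (x - z0)
               + 1/2 * (norm (orth_proj V1 (x - z0)))\<^sup>2 - 1/2 * (norm (orth_proj V2 (x - z0)))\<^sup>2)"

lemma wells_gap_quad_on:
  assumes S: "quad_on z0 S f G V1 V2" and T: "quad_on z0 T f G W1 W2"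
    and z0: "z0 \<in> S" "z0 \<in> T" and "x \<in> S" "y \<in> T"
  shows "wells_gap f G x y = - 2 * inner (orth_proj V2 (x - z0)) (orth_proj W1 (y - z0))"
proof (rule wells_gap_quadratic)
  have V: "orth_decomp (tangent_space S) V1 V2" and W: "orth_decomp (tangent_space T) W1 W2"
    using S T by (simp_all add: quad_on_def)
  show "inner (orth_proj V1 (x - z0)) (orth_proj V2 (x - z0)) = 0"
    "inner (orth_proj W1 (y - z0)) (orth_proj W2 (y - z0)) = 0"
    using V W by (simp_all add: orth_decomp_orthogonal)
  show "x - z0 = orth_proj V1 (x - z0) + orth_proj V2 (x - z0)"
    "y - z0 = orth_proj W1 (y - z0) + orth_proj W2 (y - z0)"
    using orth_decomp_sum[OF V diff_mem_tangent_space] orth_decomp_sum[OF W diff_mem_tangent_space]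
      assms by simp_all
  show "G x = G z0 + orth_proj V1 (x - z0) - orth_proj V2 (x - z0)"
    "f x = f z0 + inner (G z0) (x - z0)
      + 1/2 * (norm (orth_proj V1 (x - z0)))\<^sup>2 - 1/2 * (norm (orth_proj V2 (x - z0)))\<^sup>2"
    using S \<open>x \<in> S\<close> unfolding quad_on_def by blast+
  show "G y = G z0 + orth_proj W1 (y - z0) - orth_proj W2 (y - z0)"
    "f y = f z0 + inner (G z0) (y - z0)
      + 1/2 * (norm (orth_proj W1 (y - z0)))\<^sup>2 - 1/2 * (norm (orth_proj W2 (y - z0)))\<^sup>2"
    using T \<open>y \<in> T\<close> unfolding quad_on_def by blast+
qed

lemma wells_gap_quad_on_self:
  assumes "quad_on z0 S f G V1 V2" "z0 \<in> S" "x \<in> S" "y \<in> S"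
  shows "wells_gap f G x y = 0"
proof -
  have "inner (orth_proj V1 (y - z0)) (orth_proj V2 (x - z0)) = 0"
    using assms(1) orth_decomp_orthogonal[of "tangent_space S"] by (simp add: quad_on_def)
  with wells_gap_quad_on[OF assms(1,1,2,2,3,4)] show ?thesis
    by (simp add: inner_commute)
qed

lemma isometric_on_quad_on:
  assumes "quad_on z0 S f G V1 V2" "z0 \<in> S"
  shows "isometric_on S G"
  unfolding isometric_on_def
proof (intro ballI)
  fix x y assume "x \<in> S" "y \<in> S"
  then have "wells_gap f G x y = 0" "wells_gap f G y x = 0"
    using wells_gap_quad_on_self[OF assms] by auto
  with wells_gap_add_swap[of f G x y] show "norm (G x - G y) = norm (x - y)"
    by simp
qed

lemma norm_diff_quad_on:
  assumes "quad_on z0 S f G V1 V2" "quad_on z0 T f G W1 W2"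
    and "z0 \<in> S" "z0 \<in> T" "x \<in> S" "y \<in> T"
  shows "(norm (G x - G y))\<^sup>2 - (norm (x - y))\<^sup>2 =
    4 * (inner (orth_proj V1 (x - z0)) (orth_proj W2 (y - z0))
       + inner (orth_proj V2 (x - z0)) (orth_proj W1 (y - z0)))"
proof -
  have "wells_gap f G x y + wells_gap f G y x
      = - 2 * inner (orth_proj V2 (x - z0)) (orth_proj W1 (y - z0))
        - 2 * inner (orth_proj V1 (x - z0)) (orth_proj W2 (y - z0))"
    using wells_gap_quad_on[OF assms] wells_gap_quad_on[OF assms(2,1,4,3,6,5)]
    by (simp add: inner_commute[of "orth_proj V1 (x - z0)"])
  then show ?thesis
    unfolding wells_gap_add_swap by simp
qed

section \<open>The two directions\<close>

text \<open>
  The formula for the gradient is the definition of the induced decomposition. On a set where the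
  gradient is isometric all Wells gaps vanish, which determines the values of \<open>u\<close> without integrating
  along segments.
\<close>

lemma quad_on_leaf:
  fixes u :: "'a::euclidean_space \<Rightarrow> real"
  assumes gap: "\<And>x y. 0 \<le> wells_gap u (grad u) x y"
    and iso: "isometric_on S (grad u)" and dec: "induced_decomp u S V1 V2" and z0: "z0 \<in> S"
  shows "quad_on z0 S u (grad u) V1 V2"
  unfolding quad_on_def
proof (intro conjI ballI)
  show V: "orth_decomp (tangent_space S) V1 V2"
    using dec by (simp add: induced_decomp_def)
  fix x assume x: "x \<in> S"
  define a where "a = orth_proj V1 (x - z0)"
  define b where "b = orth_proj V2 (x - z0)"
  have ab: "x - z0 = a + b" "inner a b = 0" "inner b a = 0"
    using orth_decomp_sum[OF V diff_mem_tangent_space[OF x z0]] orth_decomp_orthogonal[OF V]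
    by (simp_all add: a_def b_def inner_commute)
  have "grad u x - grad u z0 = a - b"
    using dec x z0 by (simp add: induced_decomp_def a_def b_def)
  then show g: "grad u x = grad u z0 + orth_proj V1 (x - z0) - orth_proj V2 (x - z0)"
    by (simp add: a_def b_def algebra_simps)
  have n: "norm (grad u z0 - grad u x) = norm (z0 - x)"
    using iso x z0 by (simp add: isometric_on_def)
  then have "wells_gap u (grad u) z0 x = 0"
    using wells_gap_add_swap[of u "grad u" z0 x] gap[of z0 x] gap[of x z0] by simp
  then have "u x = u z0 + 1/2 * inner (grad u z0 + grad u x) (x - z0)"
    using n by (simp add: wells_gap_def)
  also have "\<dots> = u z0 + inner (grad u z0) (x - z0) + 1/2 * inner (a - b) (a + b)"
  proof -
    have "grad u z0 + grad u x = 2 *\<^sub>R grad u z0 + (a - b)"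
      using g by (simp add: a_def b_def scaleR_2)
    then have "inner (grad u z0 + grad u x) (x - z0)
        = 2 * inner (grad u z0) (x - z0) + inner (a - b) (x - z0)"
      by (simp only: inner_add_left inner_scaleR_left)
    then show ?thesis
      by (simp only: ab(1)) simp
  qed
  also have "\<dots> = u z0 + inner (grad u z0) (x - z0) + 1/2 * (norm a)\<^sup>2 - 1/2 * (norm b)\<^sup>2"
    using ab by (simp add: inner_simps power2_norm_eq_inner)
  finally show "u x = u z0 + inner (grad u z0) (x - z0)
      + 1/2 * (norm (orth_proj V1 (x - z0)))\<^sup>2 - 1/2 * (norm (orth_proj V2 (x - z0)))\<^sup>2"
    by (simp add: a_def b_def)
qed

lemma intersecting_leaves:
  fixes u :: "'a::euclidean_space \<Rightarrow> real"
  assumes u: "C11 u" "1-lipschitz_on UNIV (grad u)"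
    and leaf: "is_leaf (grad u) S1" "is_leaf (grad u) S2" "S1 \<noteq> S2"
    and dec: "induced_decomp u S1 V11 V12" "induced_decomp u S2 V21 V22"
    and z0: "z0 \<in> S1" "z0 \<in> S2"
  shows "\<lbrakk>x \<in> S1; y \<in> S2\<rbrakk> \<Longrightarrow> inner (orth_proj V11 (x - z0)) (orth_proj V22 (y - z0)) \<le> 0"
    and "\<lbrakk>x \<in> S1; y \<in> S2\<rbrakk> \<Longrightarrow> inner (orth_proj V12 (x - z0)) (orth_proj V21 (y - z0)) \<le> 0"
    and "z \<in> S1 \<inter> S2 \<Longrightarrow> orth_proj V11 (z - z0) = orth_proj V21 (z - z0)"
    and "z \<in> S1 \<inter> S2 \<Longrightarrow> orth_proj V12 (z - z0) = orth_proj V22 (z - z0)"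
    and "\<lbrakk>x \<in> rel_interior S1; y \<in> rel_interior S2\<rbrakk> \<Longrightarrow>
      inner (orth_proj V11 (x - z0)) (orth_proj V22 (y - z0)) < 0 \<or>
      inner (orth_proj V12 (x - z0)) (orth_proj V21 (y - z0)) < 0"
proof -
  have gap: "0 \<le> wells_gap u (grad u) x y" for x y
    using u by (intro wells_gap_nonneg_of_gradient gderiv_grad) (auto simp: C11_def)
  have iso: "isometric_on S1 (grad u)" "isometric_on S2 (grad u)"
    using leaf by (simp_all add: is_leaf_def)
  have q1: "quad_on z0 S1 u (grad u) V11 V12" and q2: "quad_on z0 S2 u (grad u) V21 V22"
    using quad_on_leaf[OF gap] iso dec z0 by auto
  have le1: "inner (orth_proj V11 (x - z0)) (orth_proj V22 (y - z0)) \<le> 0"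
    and le2: "inner (orth_proj V12 (x - z0)) (orth_proj V21 (y - z0)) \<le> 0"
    if "x \<in> S1" "y \<in> S2" for x y
    using wells_gap_quad_on[OF q1 q2 z0 that] wells_gap_quad_on[OF q2 q1 z0(2,1) that(2,1)]
      gap[of x y] gap[of y x]
    by (simp_all add: inner_commute)
  then show "\<lbrakk>x \<in> S1; y \<in> S2\<rbrakk> \<Longrightarrow> inner (orth_proj V11 (x - z0)) (orth_proj V22 (y - z0)) \<le> 0"
    and "\<lbrakk>x \<in> S1; y \<in> S2\<rbrakk> \<Longrightarrow> inner (orth_proj V12 (x - z0)) (orth_proj V21 (y - z0)) \<le> 0"
    by auto
  have dec1: "orth_decomp (tangent_space S1) V11 V12"
    and dec2: "orth_decomp (tangent_space S2) V21 V22"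
    using q1 q2 by (simp_all add: quad_on_def)
  have eq: "orth_proj V11 (z - z0) = orth_proj V21 (z - z0) \<and>
      orth_proj V12 (z - z0) = orth_proj V22 (z - z0)" if "z \<in> S1 \<inter> S2"
  proof -
    let ?a = "orth_proj V11 (z - z0)" and ?b = "orth_proj V12 (z - z0)"
      and ?c = "orth_proj V21 (z - z0)" and ?d = "orth_proj V22 (z - z0)"
    have sum: "?a + ?b = ?c + ?d"
      using orth_decomp_sum[OF dec1 diff_mem_tangent_space] that z0
        orth_decomp_sum[OF dec2 diff_mem_tangent_space] by simp
    have diff: "?a - ?b = ?c - ?d"
      using dec that z0 unfolding induced_decomp_def by (metis IntD1 IntD2)
    have "2 *\<^sub>R ?a = (?a + ?b) + (?a - ?b)" by (simp add: scaleR_2)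
    also have "\<dots> = (?c + ?d) + (?c - ?d)" using sum diff by (rule arg_cong2)
    also have "\<dots> = 2 *\<^sub>R ?c" by (simp add: scaleR_2)
    finally have "?a = ?c" by simp
    with sum show ?thesis by simp
  qed
  then show "z \<in> S1 \<inter> S2 \<Longrightarrow> orth_proj V11 (z - z0) = orth_proj V21 (z - z0)"
    and "z \<in> S1 \<inter> S2 \<Longrightarrow> orth_proj V12 (z - z0) = orth_proj V22 (z - z0)"
    by auto
  show "inner (orth_proj V11 (x - z0)) (orth_proj V22 (y - z0)) < 0 \<or>
      inner (orth_proj V12 (x - z0)) (orth_proj V21 (y - z0)) < 0"
    if xy: "x \<in> rel_interior S1" "y \<in> rel_interior S2"
  proof (rule ccontr)
    assume neg: "\<not> ?thesis"
    have sub: "subspace V11" "subspace V12" "subspace V21" "subspace V22"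
      using dec1 dec2 by (simp_all add: orth_decomp_def)
    have xS: "x \<in> S1" and yS: "y \<in> S2"
      using xy rel_interior_subset by blast+
    have 0: "inner (orth_proj V11 (x - z0)) (orth_proj V22 (y - z0)) = 0"
      "inner (orth_proj V12 (x - z0)) (orth_proj V21 (y - z0)) = 0"
      using neg le1[OF xS yS] le2[OF xS yS] by auto
    have 1: "inner (orth_proj V11 (x' - z0)) (orth_proj V22 (y - z0)) = 0"
      "inner (orth_proj V12 (x' - z0)) (orth_proj V21 (y - z0)) = 0" if "x' \<in> S1" for x'
      using linear_nonpos_vanishes[OF linear_inner_orth_proj(1)[OF sub(1)] le1 xy(1) 0(1) that]
        linear_nonpos_vanishes[OF linear_inner_orth_proj(1)[OF sub(2)] le2 xy(1) 0(2) that] yS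
      by auto
    have 2: "inner (orth_proj V11 (x' - z0)) (orth_proj V22 (y' - z0)) = 0"
      "inner (orth_proj V12 (x' - z0)) (orth_proj V21 (y' - z0)) = 0"
      if "x' \<in> S1" "y' \<in> S2" for x' y'
      using linear_nonpos_vanishes[OF linear_inner_orth_proj(2)[OF sub(4)] le1 xy(2) 1(1)[OF that(1)] that(2)]
        linear_nonpos_vanishes[OF linear_inner_orth_proj(2)[OF sub(3)] le2 xy(2) 1(2)[OF that(1)] that(2)] that
      by auto
    have mixed: "norm (grad u x' - grad u y') = norm (x' - y')" if "x' \<in> S1" "y' \<in> S2" for x' y'
      using norm_diff_quad_on[OF q1 q2 z0 that] 2[OF that] by simp
    have "isometric_on (S1 \<union> S2) (grad u)"
      using iso mixed unfolding isometric_on_def by (metis Un_iff norm_minus_commute)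
    then have "S1 \<union> S2 = S1" "S1 \<union> S2 = S2"
      using leaf(1,2) unfolding is_leaf_def by blast+
    with leaf(3) show False by blast
  qed
qed

lemma extension_with_distinct_leaves:
  fixes S1 S2 :: "'a::euclidean_space set"
  assumes conv: "convex S1" "convex S2"
    and dec: "orth_decomp (tangent_space S1) V11 V12" "orth_decomp (tangent_space S2) V21 V22"
    and z0: "z0 \<in> S1" "z0 \<in> S2"
    and le1: "\<And>x y. \<lbrakk>x \<in> S1; y \<in> S2\<rbrakk> \<Longrightarrow> inner (orth_proj V11 (x - z0)) (orth_proj V22 (y - z0)) \<le> 0"
    and le2: "\<And>x y. \<lbrakk>x \<in> S1; y \<in> S2\<rbrakk> \<Longrightarrow> inner (orth_proj V12 (x - z0)) (orth_proj V21 (y - z0)) \<le> 0"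
    and eq: "\<And>z. z \<in> S1 \<inter> S2 \<Longrightarrow> orth_proj V11 (z - z0) = orth_proj V21 (z - z0) \<and>
      orth_proj V12 (z - z0) = orth_proj V22 (z - z0)"
    and strict: "\<And>x y. \<lbrakk>x \<in> rel_interior S1; y \<in> rel_interior S2\<rbrakk> \<Longrightarrow>
      inner (orth_proj V11 (x - z0)) (orth_proj V22 (y - z0)) < 0 \<or>
      inner (orth_proj V12 (x - z0)) (orth_proj V21 (y - z0)) < 0"
  shows "\<exists>w. C11 w \<and> 1-lipschitz_on UNIV (grad w) \<and>
       (\<forall>x\<in>S1. w x = 1/2 * (norm (orth_proj V11 (x - z0)))\<^sup>2
                    - 1/2 * (norm (orth_proj V12 (x - z0)))\<^sup>2) \<and>
       (\<forall>x\<in>S2. w x = 1/2 * (norm (orth_proj V21 (x - z0)))\<^sup>2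
                    - 1/2 * (norm (orth_proj V22 (x - z0)))\<^sup>2) \<and>
       (\<exists>L1 L2. is_leaf (grad w) L1 \<and> is_leaf (grad w) L2 \<and> L1 \<noteq> L2 \<and>
                S1 \<subseteq> L1 \<and> S2 \<subseteq> L2)"
proof -
  define q where "q V W x = 1/2 * (norm (orth_proj V (x - z0)))\<^sup>2
      - 1/2 * (norm (orth_proj W (x - z0)))\<^sup>2" for V W x
  define r where "r V W x = orth_proj V (x - z0) - orth_proj W (x - z0)" for V W x
  define f where "f x = (if x \<in> S1 then q V11 V12 x else q V21 V22 x)" for x
  define G where "G x = (if x \<in> S1 then r V11 V12 x else r V21 V22 x)" for x
  have f: "f x = q V11 V12 x" "G x = r V11 V12 x" if "x \<in> S1" for x
    using that by (simp_all add: f_def G_def)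
  \<comment> \<open>on \<open>S1 \<inter> S2\<close> the two definitions agree by \<open>eq\<close>\<close>
  have f': "f x = q V21 V22 x" "G x = r V21 V22 x" if "x \<in> S2" for x
    using that eq by (auto simp: f_def G_def q_def r_def)
  have f0: "f z0 = 0" "G z0 = 0"
    using dec z0 f[of z0] by (simp_all add: q_def r_def orth_proj_0 orth_decomp_def)
  have q1: "quad_on z0 S1 f G V11 V12" and q2: "quad_on z0 S2 f G V21 V22"
    unfolding quad_on_def f0 using f f' dec by (simp_all add: q_def r_def)
  have "0 \<le> wells_gap f G x y" if "x \<in> S1 \<union> S2" "y \<in> S1 \<union> S2" for x y
    using that
  proof (elim UnE)
    assume "x \<in> S1" "y \<in> S2"
    then show ?thesis using wells_gap_quad_on[OF q1 q2 z0] le2 by simp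
  next
    assume "x \<in> S2" "y \<in> S1"
    then show ?thesis using wells_gap_quad_on[OF q2 q1 z0(2,1)] le1 by (simp add: inner_commute)
  qed (simp_all add: wells_gap_quad_on_self[OF q1 z0(1)] wells_gap_quad_on_self[OF q2 z0(2)])
  then obtain w where w: "C11 w" "1-lipschitz_on UNIV (grad w)"
    and wE: "\<And>x. x \<in> S1 \<union> S2 \<Longrightarrow> w x = f x" "\<And>x. x \<in> S1 \<union> S2 \<Longrightarrow> grad w x = G x"
    using wells_extension[of "S1 \<union> S2" f G] z0 by blast
  have "isometric_on S1 (grad w)" "isometric_on S2 (grad w)"
    using isometric_on_quad_on[OF q1 z0(1)] isometric_on_quad_on[OF q2 z0(2)] wE
    by (simp_all add: isometric_on_def)
  then obtain L1 L2 where L: "is_leaf (grad w) L1" "S1 \<subseteq> L1" "is_leaf (grad w) L2" "S2 \<subseteq> L2"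
    using isometric_on_subset_leaf by metis
  have "L1 \<noteq> L2"
  proof
    assume "L1 = L2"
    obtain x y where xy: "x \<in> rel_interior S1" "y \<in> rel_interior S2"
      using conv z0 rel_interior_eq_empty by blast
    then have S: "x \<in> S1" "y \<in> S2"
      using rel_interior_subset by blast+
    then have "x \<in> L1" "y \<in> L1"
      using L \<open>L1 = L2\<close> by auto
    moreover have "isometric_on L1 (grad w)"
      using L(1) by (simp add: is_leaf_def)
    ultimately have "norm (grad w x - grad w y) = norm (x - y)"
      by (simp add: isometric_on_def)
    then have "norm (G x - G y) = norm (x - y)"
      using wE S by simp
    with norm_diff_quad_on[OF q1 q2 z0 S] strict[OF xy] le1[OF S] le2[OF S] show False
      by simp
  qed
  have "\<exists>L1 L2. is_leaf (grad w) L1 \<and> is_leaf (grad w) L2 \<and> L1 \<noteq> L2 \<and> S1 \<subseteq> L1 \<and> S2 \<subseteq> L2"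
    using L \<open>L1 \<noteq> L2\<close> by blast
  moreover have "\<forall>x\<in>S1. w x = q V11 V12 x" "\<forall>x\<in>S2. w x = q V21 V22 x"
    using wE f(1) f'(1) by simp_all
  ultimately show ?thesis
    using w unfolding q_def by blast
qed

theorem theorem2p12:
  shows
    "(\<forall>(u :: real ^ 'n \<Rightarrow> real) S1 S2 V11 V12 V21 V22 z0.
        C11 u \<and> 1-lipschitz_on UNIV (grad u) \<and>
        is_leaf (grad u) S1 \<and> is_leaf (grad u) S2 \<and> S1 \<noteq> S2 \<and>
        S1 \<inter> S2 \<noteq> {} \<and> (S1 \<inter> S2) face_of S1 \<and> (S1 \<inter> S2) face_of S2 \<and>
        induced_decomp u S1 V11 V12 \<and> induced_decomp u S2 V21 V22 \<and>
        z0 \<in> S1 \<inter> S2 \<longrightarrow>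
          (\<forall>x\<in>S1. \<forall>y\<in>S2. inner (orth_proj V11 (x - z0)) (orth_proj V22 (y - z0)) \<le> 0) \<and>
          (\<forall>x\<in>S1. \<forall>y\<in>S2. inner (orth_proj V12 (x - z0)) (orth_proj V21 (y - z0)) \<le> 0) \<and>
          (\<forall>z\<in>S1 \<inter> S2. orth_proj V11 (z - z0) = orth_proj V21 (z - z0) \<and>
                        orth_proj V12 (z - z0) = orth_proj V22 (z - z0)) \<and>
          (\<forall>x\<in>rel_interior S1. \<forall>y\<in>rel_interior S2.
             inner (orth_proj V11 (x - z0)) (orth_proj V22 (y - z0)) < 0 \<or>
             inner (orth_proj V12 (x - z0)) (orth_proj V21 (y - z0)) < 0))
     \<and>
     (\<forall>(S1 :: (real ^ 'n) set) S2 V11 V12 V21 V22 z0.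
        convex S1 \<and> convex S2 \<and>
        S1 \<inter> S2 \<noteq> {} \<and> (S1 \<inter> S2) face_of S1 \<and> (S1 \<inter> S2) face_of S2 \<and>
        S1 \<inter> S2 = rel_frontier S1 \<inter> rel_frontier S2 \<and>
        orth_decomp (tangent_space S1) V11 V12 \<and> orth_decomp (tangent_space S2) V21 V22 \<and>
        z0 \<in> S1 \<inter> S2 \<and>
        (\<forall>x\<in>S1. \<forall>y\<in>S2. inner (orth_proj V11 (x - z0)) (orth_proj V22 (y - z0)) \<le> 0) \<and>
        (\<forall>x\<in>S1. \<forall>y\<in>S2. inner (orth_proj V12 (x - z0)) (orth_proj V21 (y - z0)) \<le> 0) \<and>
        (\<forall>z\<in>S1 \<inter> S2. orth_proj V11 (z - z0) = orth_proj V21 (z - z0) \<and>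
                      orth_proj V12 (z - z0) = orth_proj V22 (z - z0)) \<and>
        (\<forall>x\<in>rel_interior S1. \<forall>y\<in>rel_interior S2.
           inner (orth_proj V11 (x - z0)) (orth_proj V22 (y - z0)) < 0 \<or>
           inner (orth_proj V12 (x - z0)) (orth_proj V21 (y - z0)) < 0) \<longrightarrow>
          (\<exists>w :: real ^ 'n \<Rightarrow> real.
             C11 w \<and> 1-lipschitz_on UNIV (grad w) \<and>
             (\<forall>x\<in>S1. w x = 1/2 * (norm (orth_proj V11 (x - z0)))\<^sup>2
                          - 1/2 * (norm (orth_proj V12 (x - z0)))\<^sup>2) \<and>
             (\<forall>x\<in>S2. w x = 1/2 * (norm (orth_proj V21 (x - z0)))\<^sup>2
                          - 1/2 * (norm (orth_proj V22 (x - z0)))\<^sup>2) \<and>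
             (\<exists>L1 L2. is_leaf (grad w) L1 \<and> is_leaf (grad w) L2 \<and> L1 \<noteq> L2 \<and>
                      S1 \<subseteq> L1 \<and> S2 \<subseteq> L2)))"
proof (rule conjI; intro allI impI; elim conjE)
  fix u :: "real ^ 'n \<Rightarrow> real" and S1 S2 V11 V12 V21 V22 z0
  assume "C11 u" "1-lipschitz_on UNIV (grad u)"
    "is_leaf (grad u) S1" "is_leaf (grad u) S2" "S1 \<noteq> S2"
    "induced_decomp u S1 V11 V12" "induced_decomp u S2 V21 V22" "z0 \<in> S1 \<inter> S2"
  note * = intersecting_leaves[OF this(1-7) IntD1[OF this(8)] IntD2[OF this(8)]]
  show "(\<forall>x\<in>S1. \<forall>y\<in>S2. inner (orth_proj V11 (x - z0)) (orth_proj V22 (y - z0)) \<le> 0) \<and>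
        (\<forall>x\<in>S1. \<forall>y\<in>S2. inner (orth_proj V12 (x - z0)) (orth_proj V21 (y - z0)) \<le> 0) \<and>
        (\<forall>z\<in>S1 \<inter> S2. orth_proj V11 (z - z0) = orth_proj V21 (z - z0) \<and>
                      orth_proj V12 (z - z0) = orth_proj V22 (z - z0)) \<and>
        (\<forall>x\<in>rel_interior S1. \<forall>y\<in>rel_interior S2.
           inner (orth_proj V11 (x - z0)) (orth_proj V22 (y - z0)) < 0 \<or>
           inner (orth_proj V12 (x - z0)) (orth_proj V21 (y - z0)) < 0)"
    by (intro conjI ballI *)
next
  fix S1 S2 :: "(real ^ 'n) set" and V11 V12 V21 V22 z0
  assume conv: "convex S1" "convex S2"
    and dec: "orth_decomp (tangent_space S1) V11 V12" "orth_decomp (tangent_space S2) V21 V22"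
    and z0: "z0 \<in> S1 \<inter> S2"
    and le1: "\<forall>x\<in>S1. \<forall>y\<in>S2. inner (orth_proj V11 (x - z0)) (orth_proj V22 (y - z0)) \<le> 0"
    and le2: "\<forall>x\<in>S1. \<forall>y\<in>S2. inner (orth_proj V12 (x - z0)) (orth_proj V21 (y - z0)) \<le> 0"
    and eq: "\<forall>z\<in>S1 \<inter> S2. orth_proj V11 (z - z0) = orth_proj V21 (z - z0) \<and>
                      orth_proj V12 (z - z0) = orth_proj V22 (z - z0)"
    and strict: "\<forall>x\<in>rel_interior S1. \<forall>y\<in>rel_interior S2.
           inner (orth_proj V11 (x - z0)) (orth_proj V22 (y - z0)) < 0 \<or>
           inner (orth_proj V12 (x - z0)) (orth_proj V21 (y - z0)) < 0"
  show "\<exists>w. C11 w \<and> 1-lipschitz_on UNIV (grad w) \<and>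
       (\<forall>x\<in>S1. w x = 1/2 * (norm (orth_proj V11 (x - z0)))\<^sup>2
                    - 1/2 * (norm (orth_proj V12 (x - z0)))\<^sup>2) \<and>
       (\<forall>x\<in>S2. w x = 1/2 * (norm (orth_proj V21 (x - z0)))\<^sup>2
                    - 1/2 * (norm (orth_proj V22 (x - z0)))\<^sup>2) \<and>
       (\<exists>L1 L2. is_leaf (grad w) L1 \<and> is_leaf (grad w) L2 \<and> L1 \<noteq> L2 \<and>
                S1 \<subseteq> L1 \<and> S2 \<subseteq> L2)"
    by (rule extension_with_distinct_leaves[OF conv dec IntD1[OF z0] IntD2[OF z0]
          le1[rule_format] le2[rule_format] eq[THEN bspec] strict[rule_format]])
qed

end
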